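(* Let $J,Q\in\mathbb{R}^{n\times n}$ with $J$ skew-symmetric and $Q$ symmetric positive definite, let $B\in\mathbb{R}^{n\times m}$ have full rank $m\le n$, and let $\mathbb{U}=[\underline{u}_1,\overline{u}_1]\times\dots\times[\underline{u}_m,\overline{u}_m]\subset\mathbb{R}^m$ with $0\in\operatorname{int}(\mathbb{U})$. Let $x^0,x_T\in\mathbb{R}^n$, $T>0$, and let the lossless system ($R=0$) $\dot x=JQx+Bu$, $y=B^\top Qx$ be controllable, i.e. $\operatorname{rank}(B,JQB,\dots,(JQ)^{n-1}B)=n$. Then any feasible solution $u\in L^1(0,T;\mathbb{U})$ of the fixed end-time problem (P$_T$) is optimal for it. Moreover, any feasible solution $(T',u)$ of the free end-time problem (P$_{\rm free}$) (with the same $x^0,x_T$) attains the same objective value as optimal solutions of (P$_T$), provided the latter exist.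
   Context: (P$_T$): $\min_{u\in L^1(0,T;\mathbb{U})}\int_0^Tu(t)^\top y(t)\,dt$ s.t. $\dot x(t)=JQx(t)+Bu(t)$, $x(0)=x^0$, $x(T)=x_T$, $y(t)=B^\top Qx(t)$. (P$_{\rm free}$): $\min_{T'\ge0,\,u\in L^1(0,T';\mathbb{U})}\int_0^{T'}u(t)^\top y(t)\,dt$ s.t. $\dot x(t)=JQx(t)+Bu(t)$, $x(0)=x^0$, $x(T')=x_T$, $y(t)=B^\top Qx(t)$. $L^1(0,T;\mathbb{U})$ is the set of Lebesgue-measurable, integrable functions with values in $\mathbb{U}$; the differential equation holds almost everywhere with absolutely continuous solution. A control is feasible if the corresponding state satisfies the initial and terminal conditions. *)

theory Defs
  imports "HOL-Analysis.Analysis"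
begin

definition absolutely_continuous_on :: "real \<Rightarrow> real \<Rightarrow> (real \<Rightarrow> 'a::real_normed_vector) \<Rightarrow> bool" where
  "absolutely_continuous_on s t f \<longleftrightarrow>
     (\<forall>\<epsilon>>0. \<exists>\<delta>>0. \<forall>(N::nat) a b.
        (\<forall>i<N. s \<le> a i \<and> a i \<le> b i \<and> b i \<le> t) \<and>
        disjoint_family_on (\<lambda>i. {a i<..<b i}) {..<N} \<and>
        (\<Sum>i<N. b i - a i) < \<delta> \<longrightarrow>
        (\<Sum>i<N. norm (f (b i) - f (a i))) < \<epsilon>)"

definition skew_symmetric :: "real^'n^'n \<Rightarrow> bool" where
  "skew_symmetric A \<longleftrightarrow> transpose A = - A"

definition symmetric_positive_definite :: "real^'n^'n \<Rightarrow> bool" where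
  "symmetric_positive_definite A \<longleftrightarrow> transpose A = A \<and> (\<forall>x. x \<noteq> 0 \<longrightarrow> x \<bullet> (A *v x) > 0)"

text \<open>The block matrix \<open>(B, A B, \<dots>, A\<^sup>n\<^sup>-\<^sup>1 B)\<close>. Its columns are indexed by pairs \<open>(k, j)\<close>, meaning
  column \<open>j\<close> of block \<open>A\<^sup>k B\<close>; the block number runs over the index type \<open>'n\<close>, identified with
  \<open>{0, \<dots>, n - 1}\<close> through the bijection \<open>to_nat_on UNIV\<close>. The order of the blocks does not affect the
  rank.\<close>

definition kalman_matrix :: "real^'n^'n \<Rightarrow> real^'m^'n \<Rightarrow> real^('n \<times> 'm)^'n" where
  "kalman_matrix A B =
     (\<chi> i p. (((\<lambda>M. A ** M) ^^ to_nat_on (UNIV :: 'n set) (fst p)) B) $ i $ snd p)"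

definition controllable :: "real^'n^'n \<Rightarrow> real^'m^'n \<Rightarrow> bool" where
  "controllable A B \<longleftrightarrow> rank (kalman_matrix A B) = CARD('n)"

definition L1_controls :: "real \<Rightarrow> (real^'m) set \<Rightarrow> (real \<Rightarrow> real^'m) set" where
  "L1_controls T U = {u. set_integrable lebesgue {0<..<T} u \<and> (\<forall>t\<in>{0<..<T}. u t \<in> U)}"

definition trajectory ::
  "real^'n^'n \<Rightarrow> real^'n^'n \<Rightarrow> real^'m^'n \<Rightarrow> real^'n \<Rightarrow> real \<Rightarrow> (real \<Rightarrow> real^'m) \<Rightarrow> (real \<Rightarrow> real^'n) \<Rightarrow> bool" where
  "trajectory J Q B x0 T u x \<longleftrightarrow>
     absolutely_continuous_on 0 T x \<and> x 0 = x0 \<and>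
     (AE t in lebesgue. t \<in> {0<..<T} \<longrightarrow>
        (x has_vector_derivative ((J ** Q) *v x t + B *v u t)) (at t))"

text \<open>The trajectory of a given control is unique on \<open>[0, T]\<close>; the choice operator is only needed
  because its values outside \<open>[0, T]\<close> are unconstrained.\<close>

definition state ::
  "real^'n^'n \<Rightarrow> real^'n^'n \<Rightarrow> real^'m^'n \<Rightarrow> real^'n \<Rightarrow> real \<Rightarrow> (real \<Rightarrow> real^'m) \<Rightarrow> real \<Rightarrow> real^'n" where
  "state J Q B x0 T u = (SOME x. trajectory J Q B x0 T u x)"

definition system_output ::
  "real^'n^'n \<Rightarrow> real^'n^'n \<Rightarrow> real^'m^'n \<Rightarrow> real^'n \<Rightarrow> real \<Rightarrow> (real \<Rightarrow> real^'m) \<Rightarrow> real \<Rightarrow> real^'m" where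
  "system_output J Q B x0 T u t = (transpose B ** Q) *v state J Q B x0 T u t"

definition supplied_energy ::
  "real^'n^'n \<Rightarrow> real^'n^'n \<Rightarrow> real^'m^'n \<Rightarrow> real^'n \<Rightarrow> real \<Rightarrow> (real \<Rightarrow> real^'m) \<Rightarrow> real" where
  "supplied_energy J Q B x0 T u =
     (LINT t:{0<..<T}|lebesgue. u t \<bullet> system_output J Q B x0 T u t)"

definition feasible ::
  "real^'n^'n \<Rightarrow> real^'n^'n \<Rightarrow> real^'m^'n \<Rightarrow> (real^'m) set \<Rightarrow> real^'n \<Rightarrow> real^'n \<Rightarrow> real \<Rightarrow>
   (real \<Rightarrow> real^'m) \<Rightarrow> bool" where
  "feasible J Q B U x0 xT T u \<longleftrightarrow>
     u \<in> L1_controls T U \<and> (\<exists>x. trajectory J Q B x0 T u x \<and> x T = xT)"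

definition optimal ::
  "real^'n^'n \<Rightarrow> real^'n^'n \<Rightarrow> real^'m^'n \<Rightarrow> (real^'m) set \<Rightarrow> real^'n \<Rightarrow> real^'n \<Rightarrow> real \<Rightarrow>
   (real \<Rightarrow> real^'m) \<Rightarrow> bool" where
  "optimal J Q B U x0 xT T u \<longleftrightarrow>
     feasible J Q B U x0 xT T u \<and>
     (\<forall>v. feasible J Q B U x0 xT T v \<longrightarrow>
        supplied_energy J Q B x0 T u \<le> supplied_energy J Q B x0 T v)"

definition feasible_free ::
  "real^'n^'n \<Rightarrow> real^'n^'n \<Rightarrow> real^'m^'n \<Rightarrow> (real^'m) set \<Rightarrow> real^'n \<Rightarrow> real^'n \<Rightarrow>
   real \<Rightarrow> (real \<Rightarrow> real^'m) \<Rightarrow> bool" where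
  "feasible_free J Q B U x0 xT T' u \<longleftrightarrow> T' \<ge> 0 \<and> feasible J Q B U x0 xT T' u"

end

theory Submission
  imports Defs
begin

text \<open>
  Along a trajectory the Hamiltonian \<open>H(x) = 1/2 x\<^sup>T Q x\<close> is absolutely continuous, and since \<open>J\<close> is
  skew-symmetric its derivative is \<open>u\<^sup>T y\<close> almost everywhere. By the fundamental theorem of calculus
  for absolutely continuous functions, the supplied energy is \<open>H(x\<^sub>T) - H(x\<^sup>0)\<close>, which depends neither
  on the control nor on the end time. The same balance, applied to the difference of two
  trajectories of one control, shows that the terminal state is determined by the control.
\<close>

subsection \<open>Absolutely continuous functions\<close>

text \<open>Enumerating a finite index set \<open>I\<close> by \<open>{..<card I}\<close> reduces
  any finite family to the ones indexed by natural numbers in the definition. This form applies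
  directly to families indexed by the pairs of a tagged division.\<close>

lemma absolutely_continuous_onE:
  assumes "absolutely_continuous_on s t f" "\<epsilon> > 0"
  obtains \<delta> where "\<delta> > 0"
    "\<And>I a b. finite I \<Longrightarrow> (\<And>i. i \<in> I \<Longrightarrow> s \<le> a i \<and> a i \<le> b i \<and> b i \<le> t) \<Longrightarrow>
       disjoint_family_on (\<lambda>i. {a i<..<b i}) I \<Longrightarrow> (\<Sum>i\<in>I. b i - a i) < \<delta> \<Longrightarrow>
       (\<Sum>i\<in>I. norm (f (b i) - f (a i))) < \<epsilon>"
proof -
  obtain \<delta> where "\<delta> > 0" and \<delta>: "\<And>(N::nat) a b.
        (\<forall>i<N. s \<le> a i \<and> a i \<le> b i \<and> b i \<le> t) \<Longrightarrow>
        disjoint_family_on (\<lambda>i. {a i<..<b i}) {..<N} \<Longrightarrow>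
        (\<Sum>i<N. b i - a i) < \<delta> \<Longrightarrow> (\<Sum>i<N. norm (f (b i) - f (a i))) < \<epsilon>"
    using assms unfolding absolutely_continuous_on_def by meson
  show thesis
  proof
    fix I :: "'b set" and a b
    assume I: "finite I" "\<And>i. i \<in> I \<Longrightarrow> s \<le> a i \<and> a i \<le> b i \<and> b i \<le> t"
      "disjoint_family_on (\<lambda>i. {a i<..<b i}) I" "(\<Sum>i\<in>I. b i - a i) < \<delta>"
    obtain h where h: "bij_betw h {..<card I} I"
      using ex_bij_betw_nat_finite[OF \<open>finite I\<close>] by (auto simp: atLeast0LessThan)
    have hI: "h i \<in> I" if "i < card I" for i
      using h that by (auto simp: bij_betw_def)
    have "(\<Sum>i<card I. norm (f (b (h i)) - f (a (h i)))) < \<epsilon>"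
    proof (rule \<delta>)
      show "\<forall>i<card I. s \<le> a (h i) \<and> a (h i) \<le> b (h i) \<and> b (h i) \<le> t"
        using I(2) hI by blast
      show "disjoint_family_on (\<lambda>i. {a (h i)<..<b (h i)}) {..<card I}"
        unfolding disjoint_family_on_def
      proof (intro ballI impI)
        fix i j assume ij: "i \<in> {..<card I}" "j \<in> {..<card I}" "i \<noteq> j"
        then have "h i \<noteq> h j"
          using h by (auto simp: bij_betw_def inj_on_def)
        with ij show "{a (h i)<..<b (h i)} \<inter> {a (h j)<..<b (h j)} = {}"
          using I(3) hI unfolding disjoint_family_on_def by blast
      qed
      show "(\<Sum>i<card I. b (h i) - a (h i)) < \<delta>"
        using I(4) sum.reindex_bij_betw[OF h, of "\<lambda>i. b i - a i"] by simp
    qed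
    then show "(\<Sum>i\<in>I. norm (f (b i) - f (a i))) < \<epsilon>"
      using sum.reindex_bij_betw[OF h, of "\<lambda>i. norm (f (b i) - f (a i))"] by simp
  qed fact
qed

text \<open>A family consisting of one interval already gives the \<epsilon>-\<delta> condition, so
  \<open>unit\<close> serves as the index type.\<close>

lemma absolutely_continuous_on_imp_continuous_on:
  fixes f :: "real \<Rightarrow> 'a::real_normed_vector"
  assumes "absolutely_continuous_on s t f"
  shows "continuous_on {s..t} f"
  unfolding continuous_on_iff
proof (intro ballI allI impI)
  fix x e :: real assume x: "x \<in> {s..t}" and "e > 0"
  obtain \<delta> where "\<delta> > 0" and \<delta>: "\<And>I a b. finite I \<Longrightarrow>
       (\<And>i::unit. i \<in> I \<Longrightarrow> s \<le> a i \<and> a i \<le> b i \<and> b i \<le> t) \<Longrightarrow>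
       disjoint_family_on (\<lambda>i. {a i<..<b i}) I \<Longrightarrow> (\<Sum>i\<in>I. b i - a i) < \<delta> \<Longrightarrow>
       (\<Sum>i\<in>I. norm (f (b i) - f (a i))) < e"
    using absolutely_continuous_onE[OF assms \<open>e > 0\<close>] by blast
  have "dist (f y) (f x) < e" if y: "y \<in> {s..t}" "dist y x < \<delta>" for y
  proof -
    \<comment> \<open>The point \<open>y\<close> may lie on either side of \<open>x\<close>;
      \<open>min\<close> and \<open>max\<close> put the endpoints in order.\<close>
    have "norm (f (max x y) - f (min x y)) < e"
      using \<delta>[of "{()}" "\<lambda>_. min x y" "\<lambda>_. max x y"] x y
      by (auto simp: disjoint_family_on_def dist_real_def)
    then show ?thesis
      by (auto simp: dist_norm norm_minus_commute max_def min_def split: if_splits)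
  qed
  with \<open>\<delta> > 0\<close> show "\<exists>d>0. \<forall>y\<in>{s..t}. dist y x < d \<longrightarrow> dist (f y) (f x) < e"
    by blast
qed

section \<open>Closure properties of absolute continuity\<close>

text \<open>Summing the increment bound over a family passes smallness from \<open>f\<close> and
  \<open>h\<close> to \<open>g\<close>. The closure properties below then reduce to estimates on a
  single increment.\<close>

lemma absolutely_continuous_on_dominated:
  fixes f :: "real \<Rightarrow> 'a::real_normed_vector" and h :: "real \<Rightarrow> 'b::real_normed_vector"
    and g :: "real \<Rightarrow> 'c::real_normed_vector"
  assumes f: "absolutely_continuous_on s t f" and h: "absolutely_continuous_on s t h"
    and le: "\<And>p q. p \<in> {s..t} \<Longrightarrow> q \<in> {s..t} \<Longrightarrow>
               norm (g q - g p) \<le> C * (norm (f q - f p) + norm (h q - h p))"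
  shows "absolutely_continuous_on s t g"
  unfolding absolutely_continuous_on_def
proof (intro allI impI)
  fix e :: real assume "e > 0"
  \<comment> \<open>The sign of \<open>C\<close> is arbitrary; \<open>c\<close> is a positive upper
    bound, so dividing by \<open>2 * c\<close> is legitimate.\<close>
  define c where "c = \<bar>C\<bar> + 1"
  have "c > 0" and "C \<le> c" by (auto simp: c_def)
  then have ec: "e / (2 * c) > 0" using \<open>e > 0\<close> by simp
  obtain d1 where "d1 > 0" and d1: "\<And>I a b. finite I \<Longrightarrow>
       (\<And>i::nat. i \<in> I \<Longrightarrow> s \<le> a i \<and> a i \<le> b i \<and> b i \<le> t) \<Longrightarrow>
       disjoint_family_on (\<lambda>i. {a i<..<b i}) I \<Longrightarrow> (\<Sum>i\<in>I. b i - a i) < d1 \<Longrightarrow>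
       (\<Sum>i\<in>I. norm (f (b i) - f (a i))) < e / (2 * c)"
    using absolutely_continuous_onE[OF f ec] by blast
  obtain d2 where "d2 > 0" and d2: "\<And>I a b. finite I \<Longrightarrow>
       (\<And>i::nat. i \<in> I \<Longrightarrow> s \<le> a i \<and> a i \<le> b i \<and> b i \<le> t) \<Longrightarrow>
       disjoint_family_on (\<lambda>i. {a i<..<b i}) I \<Longrightarrow> (\<Sum>i\<in>I. b i - a i) < d2 \<Longrightarrow>
       (\<Sum>i\<in>I. norm (h (b i) - h (a i))) < e / (2 * c)"
    using absolutely_continuous_onE[OF h ec] by blast
  show "\<exists>\<delta>>0. \<forall>(N::nat) a b. (\<forall>i<N. s \<le> a i \<and> a i \<le> b i \<and> b i \<le> t) \<and>
        disjoint_family_on (\<lambda>i. {a i<..<b i}) {..<N} \<and> (\<Sum>i<N. b i - a i) < \<delta> \<longrightarrow>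
        (\<Sum>i<N. norm (g (b i) - g (a i))) < e"
  proof (intro exI[of _ "min d1 d2"] conjI allI impI)
    show "min d1 d2 > 0" using \<open>d1 > 0\<close> \<open>d2 > 0\<close> by simp
    fix N :: nat and a b
    assume A: "(\<forall>i<N. s \<le> a i \<and> a i \<le> b i \<and> b i \<le> t) \<and>
        disjoint_family_on (\<lambda>i. {a i<..<b i}) {..<N} \<and> (\<Sum>i<N. b i - a i) < min d1 d2"
    have "norm (g (b i) - g (a i)) \<le> c * (norm (f (b i) - f (a i)) + norm (h (b i) - h (a i)))"
      if "i < N" for i
    proof -
      have "a i \<in> {s..t}" "b i \<in> {s..t}" using A that by force+
      from le[OF this] show ?thesis
        by (rule order_trans) (intro mult_right_mono \<open>C \<le> c\<close> add_nonneg_nonneg norm_ge_zero)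
    qed
    then have "(\<Sum>i<N. norm (g (b i) - g (a i)))
        \<le> c * ((\<Sum>i<N. norm (f (b i) - f (a i))) + (\<Sum>i<N. norm (h (b i) - h (a i))))"
      by (auto simp: sum_distrib_left sum.distrib[symmetric] intro!: sum_mono)
    also have "\<dots> < c * (e / (2 * c) + e / (2 * c))"
      using A \<open>c > 0\<close> by (intro mult_strict_left_mono add_strict_mono d1 d2) auto
    also have "\<dots> = e" using \<open>c > 0\<close> by (simp add: field_simps)
    finally show "(\<Sum>i<N. norm (g (b i) - g (a i))) < e" .
  qed
qed

lemma absolutely_continuous_on_diff:
  assumes "absolutely_continuous_on s t f" "absolutely_continuous_on s t h"
  shows "absolutely_continuous_on s t (\<lambda>x. f x - h x)"
proof (rule absolutely_continuous_on_dominated[OF assms, of _ 1])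
  fix p q
  have "norm (f q - h q - (f p - h p)) = norm ((f q - f p) - (h q - h p))"
    by (simp add: algebra_simps)
  also have "\<dots> \<le> norm (f q - f p) + norm (h q - h p)"
    by (rule norm_triangle_ineq4)
  finally show "norm (f q - h q - (f p - h p)) \<le> 1 * (norm (f q - f p) + norm (h q - h p))"
    by simp
qed

text \<open>The increment of a product splits as in the product rule, and both factors are bounded
  because they are continuous on a compact interval.\<close>

lemma absolutely_continuous_on_bilinear:
  assumes "bounded_bilinear bil"
    and f: "absolutely_continuous_on s t f" and h: "absolutely_continuous_on s t h"
  shows "absolutely_continuous_on s t (\<lambda>x. bil (f x) (h x))"
proof -
  interpret bounded_bilinear bil by fact
  obtain K where "K > 0" and K: "\<And>x y. norm (bil x y) \<le> norm x * norm y * K"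
    using pos_bounded by blast
  have "bounded (f ` {s..t})" "bounded (h ` {s..t})"
    using f h by (auto intro!: compact_imp_bounded compact_continuous_image
        absolutely_continuous_on_imp_continuous_on)
  then obtain F H where F: "\<And>p. p \<in> {s..t} \<Longrightarrow> norm (f p) \<le> F"
    and H: "\<And>p. p \<in> {s..t} \<Longrightarrow> norm (h p) \<le> H"
    unfolding bounded_iff by blast
  show ?thesis
  proof (rule absolutely_continuous_on_dominated[OF f h, of _ "K * (\<bar>F\<bar> + \<bar>H\<bar>)"])
    fix p q assume pq: "p \<in> {s..t}" "q \<in> {s..t}"
    have "bil (f q) (h q) - bil (f p) (h p)
        = bil (f q - f p) (h q) + bil (f p) (h q - h p)"
      by (simp add: diff_left diff_right)
    then have "norm (bil (f q) (h q) - bil (f p) (h p))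
        \<le> norm (f q - f p) * norm (h q) * K + norm (f p) * norm (h q - h p) * K"
      using norm_triangle_le[OF add_mono[OF K K]] by metis
    also have "\<dots> \<le> norm (f q - f p) * (\<bar>F\<bar> + \<bar>H\<bar>) * K + (\<bar>F\<bar> + \<bar>H\<bar>) * norm (h q - h p) * K"
      using F[OF pq(1)] H[OF pq(2)] \<open>K > 0\<close>
      by (intro add_mono mult_right_mono mult_left_mono) auto
    finally show "norm (bil (f q) (h q) - bil (f p) (h p))
        \<le> K * (\<bar>F\<bar> + \<bar>H\<bar>) * (norm (f q - f p) + norm (h q - h p))"
      by (simp add: algebra_simps)
  qed
qed

lemma absolutely_continuous_on_linear:
  assumes "bounded_linear L" and f: "absolutely_continuous_on s t f"
  shows "absolutely_continuous_on s t (\<lambda>x. L (f x))"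
proof -
  interpret bounded_linear L by fact
  obtain K where "K \<ge> 0" and K: "\<And>x. norm (L x) \<le> norm x * K"
    using nonneg_bounded by blast
  show ?thesis
  proof (rule absolutely_continuous_on_dominated[OF f f, of _ K])
    fix p q
    have "norm (L (f q) - L (f p)) \<le> norm (f q - f p) * K"
      using K[of "f q - f p"] by (simp add: diff)
    also have "\<dots> \<le> K * (norm (f q - f p) + norm (f q - f p))"
      using \<open>K \<ge> 0\<close> by (simp add: algebra_simps)
    finally show "norm (L (f q) - L (f p)) \<le> K * (norm (f q - f p) + norm (f q - f p))" .
  qed
qed

text \<open>
  The gauge handles the exceptional null set \<open>N\<close> by an open cover of small measure: the tagged
  intervals with tag in \<open>N\<close> have small total length, so absolute continuity bounds their
  contribution.
\<close>

theorem fundamental_theorem_of_calculus_absolutely_continuous: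
  fixes f :: "real \<Rightarrow> 'a::real_normed_vector"
  assumes "a \<le> b" and ac: "absolutely_continuous_on a b f" and N: "negligible N"
    and der: "\<And>x. x \<in> {a..b} - N \<Longrightarrow> (f has_vector_derivative g x) (at x within {a..b})"
  shows "(g has_integral (f b - f a)) {a..b}"
proof (rule has_integral_spike[OF N])
  show "g x = (if x \<in> N then 0 else g x)" if "x \<in> {a..b} - N" for x
    using that by simp
  \<comment> \<open>With the integrand set to zero on \<open>N\<close>, a tag in \<open>N\<close>
    contributes no Riemann term, and only the increment of \<open>f\<close> has to be controlled
    there.\<close>
  let ?g = "\<lambda>x. if x \<in> N then 0 else g x"
  show "(?g has_integral (f b - f a)) {a..b}"
    unfolding has_integral_real
  proof (intro allI impI)
    fix e :: real assume "e > 0"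
    \<comment> \<open>The errors at regular tags add up to \<open>e1 * (b - a)\<close>, which is to
      stay below \<open>e / 2\<close>; the \<open>+ 1\<close> keeps the denominator positive when
      \<open>a = b\<close>.\<close>
    define e1 where "e1 = e / (2 * (b - a + 1))"
    have "e1 > 0" using \<open>e > 0\<close> \<open>a \<le> b\<close> by (simp add: e1_def)
    have e1: "e1 * (b - a) \<le> e / 2"
      using \<open>e > 0\<close> \<open>a \<le> b\<close> by (simp add: e1_def field_simps)
    obtain \<delta> where "\<delta> > 0" and \<delta>: "\<And>I u v. finite I \<Longrightarrow>
       (\<And>i::real \<times> real set. i \<in> I \<Longrightarrow> a \<le> u i \<and> u i \<le> v i \<and> v i \<le> b) \<Longrightarrow>
       disjoint_family_on (\<lambda>i. {u i<..<v i}) I \<Longrightarrow> (\<Sum>i\<in>I. v i - u i) < \<delta> \<Longrightarrow>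
       (\<Sum>i\<in>I. norm (f (v i) - f (u i))) < e / 2"
      using absolutely_continuous_onE[OF ac half_gt_zero[OF \<open>e > 0\<close>]] by blast
    obtain G where G: "open G" "N \<subseteq> G" "G \<in> lmeasurable" "measure lebesgue G < \<delta>"
    proof -
      have "N \<in> sets lebesgue" using N by (simp add: negligible_imp_sets)
      then obtain G where G: "open G" "N \<subseteq> G" "G - N \<in> lmeasurable" "emeasure lebesgue (G - N) < ennreal \<delta>"
        using sets_lebesgue_outer_open[OF _ \<open>\<delta> > 0\<close>] by metis
      have "(G - N) \<union> N = G" using G(2) by blast
      moreover have "measure lebesgue ((G - N) \<union> N) = measure lebesgue (G - N)"
        using G(3) N by (intro measure_Un_null_set) (auto simp: negligible_iff_null_sets)
      moreover have "(G - N) \<union> N \<in> lmeasurable"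
        using G(3) N by (intro fmeasurable.Un) (auto simp: negligible_imp_measurable)
      moreover have "measure lebesgue (G - N) < \<delta>"
        using G(3,4) \<open>\<delta> > 0\<close> by (simp add: emeasure_eq_measure2 ennreal_less_iff)
      ultimately show thesis using that[of G] G by simp
    qed
    \<comment> \<open>The restriction to regular points stands inside the existential, so choice
      yields a positive radius at every point.\<close>
    have "\<forall>x. \<exists>d>0. x \<in> {a..b} - N \<longrightarrow>
        (\<forall>y\<in>{a..b}. norm (y-x) < d \<longrightarrow> norm (f y - f x - (y-x) *\<^sub>R g x) \<le> e1 * norm (y-x))"
      using der[unfolded has_vector_derivative_def has_derivative_within_alt] \<open>e1 > 0\<close>
      by (metis zero_less_one)
    then obtain d where d: "\<And>x. 0 < d x" "\<And>x y. \<lbrakk>x \<in> {a..b} - N; y \<in> {a..b}; norm (y-x) < d x\<rbrakk>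
        \<Longrightarrow> norm (f y - f x - (y-x) *\<^sub>R g x) \<le> e1 * norm (y-x)"
      by metis
    define \<gamma> where "\<gamma> x = (if x \<in> N then G else ball x (d x))" for x
    show "\<exists>\<gamma>. gauge \<gamma> \<and> (\<forall>\<D>. \<D> tagged_division_of {a..b} \<and> \<gamma> fine \<D> \<longrightarrow>
        norm ((\<Sum>(x, K)\<in>\<D>. measure lborel K *\<^sub>R ?g x) - (f b - f a)) < e)"
    proof (intro exI[of _ \<gamma>] conjI allI impI; (elim conjE)?)
      show "gauge \<gamma>"
        using G d(1) by (auto simp: gauge_def \<gamma>_def)
      fix p assume p: "p tagged_division_of {a..b}" and fine: "\<gamma> fine p"
      have ivl: "\<exists>u v. K = {u..v} \<and> u \<le> x \<and> x \<le> v \<and> a \<le> u \<and> v \<le> b \<and> Inf K = u \<and> Sup K = v"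
        if "(x, K) \<in> p" for x K
      proof -
        have "x \<in> K" "K \<subseteq> {a..b}" "\<exists>u v. K = cbox u v"
          using p that by blast+
        then show ?thesis by auto
      qed
      define p0 where "p0 = {z \<in> p. fst z \<in> N}"
      have "finite p" using p by blast
      then have "finite p0" by (simp add: p0_def)
      \<comment> \<open>Reading the endpoints off as \<open>Inf\<close> and \<open>Sup\<close> turns
        the tagged pairs themselves into the index set of an interval family. Distinct pairs have
        disjoint interiors, even if some intervals are degenerate.\<close>
      have disj: "disjoint_family_on (\<lambda>z. {Inf (snd z)<..<Sup (snd z)}) p0"
        unfolding disjoint_family_on_def
      proof (intro ballI impI)
        fix z w assume zw: "z \<in> p0" "w \<in> p0" "z \<noteq> w"
        obtain x K y L where z: "z = (x, K)" and w: "w = (y, L)" by fastforce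
        have zp: "(x, K) \<in> p" "(y, L) \<in> p" using zw by (auto simp: z w p0_def)
        then have "interior K \<inter> interior L = {}"
          using tagged_division_ofD(5)[OF p] zw(3) z w by blast
        moreover have "interior K = {Inf K<..<Sup K}" "interior L = {Inf L<..<Sup L}"
          using ivl[OF zp(1)] ivl[OF zp(2)] interior_atLeastAtMost_real by metis+
        ultimately show "{Inf (snd z)<..<Sup (snd z)} \<inter> {Inf (snd w)<..<Sup (snd w)} = {}"
          by (simp only: z w snd_conv)
      qed
      \<comment> \<open>The total length is the measure of a disjoint union of open intervals, all
        inside \<open>G\<close> by fineness.\<close>
      have "(\<Sum>z\<in>p0. Sup (snd z) - Inf (snd z))
          = (\<Sum>z\<in>p0. measure lebesgue {Inf (snd z)<..<Sup (snd z)})"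
      proof (rule sum.cong[OF refl])
        fix z assume "z \<in> p0"
        then have "Inf (snd z) \<le> Sup (snd z)"
          using ivl[of "fst z" "snd z"] by (auto simp: p0_def)
        then show "Sup (snd z) - Inf (snd z) = measure lebesgue {Inf (snd z)<..<Sup (snd z)}"
          by simp
      qed
      also have "\<dots> = measure lebesgue (\<Union>z\<in>p0. {Inf (snd z)<..<Sup (snd z)})"
        using disj \<open>finite p0\<close>
        by (intro measure_UNION'[symmetric])
           (auto simp: disjoint_family_on_def pairwise_def disjnt_def)
      also have "\<dots> \<le> measure lebesgue G"
      proof (rule measure_mono_fmeasurable[OF _ _ G(3)])
        show "(\<Union>z\<in>p0. {Inf (snd z)<..<Sup (snd z)}) \<subseteq> G"
        proof (rule UN_least)
          fix z assume z: "z \<in> p0"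
          then have "snd z \<subseteq> G"
            using fine unfolding fine_def \<gamma>_def p0_def by fastforce
          moreover have "{Inf (snd z)<..<Sup (snd z)} \<subseteq> snd z"
          proof -
            have "(fst z, snd z) \<in> p" using z by (simp add: p0_def)
            from ivl[OF this] obtain u v where
              "snd z = {u..v}" "Inf (snd z) = u" "Sup (snd z) = v" by blast
            then show ?thesis by (metis greaterThanLessThan_subseteq_atLeastAtMost_iff order_refl)
          qed
          ultimately show "{Inf (snd z)<..<Sup (snd z)} \<subseteq> G" by blast
        qed
      qed (use \<open>finite p0\<close> in auto)
      also have "\<dots> < \<delta>" by (rule G(4))
      finally have "(\<Sum>z\<in>p0. Sup (snd z) - Inf (snd z)) < \<delta>" .
      then have small: "(\<Sum>z\<in>p0. norm (f (Sup (snd z)) - f (Inf (snd z)))) < e / 2"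
      proof (intro \<delta> \<open>finite p0\<close> disj)
        fix z assume "z \<in> p0"
        then show "a \<le> Inf (snd z) \<and> Inf (snd z) \<le> Sup (snd z) \<and> Sup (snd z) \<le> b"
          using ivl[of "fst z" "snd z"] by (force simp: p0_def)
      qed
      \<comment> \<open>The error of one Riemann term is charged either to the length of its
        interval or, for a tag in \<open>N\<close>, to the increment of \<open>f\<close>.\<close>
      have summand: "norm (measure lborel K *\<^sub>R ?g x - (f (Sup K) - f (Inf K)))
          \<le> e1 * (Sup K - Inf K) + (if x \<in> N then norm (f (Sup K) - f (Inf K)) else 0)"
        if xK: "(x, K) \<in> p" for x K
      proof -
        obtain u v where K: "K = {u..v}" "u \<le> x" "x \<le> v" "a \<le> u" "v \<le> b" "Inf K = u" "Sup K = v"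
          using ivl[OF xK] by blast
        show ?thesis
        proof (cases "x \<in> N")
          case True
          have "0 \<le> e1 * (v - u)" using K \<open>e1 > 0\<close> by simp
          then show ?thesis
            unfolding K(6,7) using True by (simp add: norm_minus_commute)
        next
          case False
          have "K \<subseteq> ball x (d x)"
            using fine xK False unfolding fine_def \<gamma>_def by fastforce
          moreover have "u \<in> K" "v \<in> K" using K by auto
          ultimately have "u \<in> ball x (d x)" "v \<in> ball x (d x)" by blast+
          then have uv: "norm (f u - f x - (u-x) *\<^sub>R g x) \<le> e1 * norm (u-x)"
              "norm (f v - f x - (v-x) *\<^sub>R g x) \<le> e1 * norm (v-x)"
            using K False by (intro d(2); force simp: dist_real_def)+
          \<comment> \<open>Straddle argument: the linear approximations at \<open>u\<close> and
            \<open>v\<close> share the tag \<open>x\<close>, and \<open>u \<le> x \<le> v\<close>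
            makes the two distances add up to \<open>v - u\<close>.\<close>
          have "norm ((v - u) *\<^sub>R g x - (f v - f u))
              = norm ((f u - f x - (u - x) *\<^sub>R g x) - (f v - f x - (v - x) *\<^sub>R g x))"
            by (auto simp: algebra_simps)
          also have "\<dots> \<le> e1 * norm (u-x) + e1 * norm (v-x)"
            using norm_triangle_ineq4 uv by (meson add_mono order_trans)
          also have "\<dots> = e1 * (v - u)"
            using K by (simp add: algebra_simps)
          finally show ?thesis
            unfolding K(6,7) using False K by simp
        qed
      qed
      \<comment> \<open>Increments telescope over the division, both for \<open>f\<close> and for
        the identity.\<close>
      have fba: "f b - f a = (\<Sum>(x,K)\<in>p. f (Sup K) - f (Inf K))"
        "b - a = (\<Sum>(x,K)\<in>p. Sup K - Inf K)"
        using additive_tagged_division_1[OF \<open>a \<le> b\<close> p, of f]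
          additive_tagged_division_1[OF \<open>a \<le> b\<close> p, of "\<lambda>x. x"] by auto
      have "norm ((\<Sum>(x, K)\<in>p. measure lborel K *\<^sub>R ?g x) - (f b - f a))
          = norm (\<Sum>(x, K)\<in>p. measure lborel K *\<^sub>R ?g x - (f (Sup K) - f (Inf K)))"
        unfolding fba(1) sum_subtractf[symmetric] by (simp add: case_prod_unfold)
      also have "\<dots> \<le> (\<Sum>(x, K)\<in>p. e1 * (Sup K - Inf K) +
          (if x \<in> N then norm (f (Sup K) - f (Inf K)) else 0))"
        using summand by (intro sum_norm_le) auto
      also have "\<dots> = e1 * (b - a) + (\<Sum>z\<in>p0. norm (f (Sup (snd z)) - f (Inf (snd z))))"
        using \<open>finite p\<close> unfolding fba(2) p0_def
        by (simp add: case_prod_unfold sum.distrib sum_distrib_left sum.inter_filter)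
      also have "\<dots> < e" using e1 small by simp
      finally show "norm ((\<Sum>(x, K)\<in>p. measure lborel K *\<^sub>R ?g x) - (f b - f a)) < e" .
    qed
  qed
qed

subsection \<open>The energy balance of the lossless system\<close>

lemma matrix_vector_inner_transpose:
  fixes A :: "real^'n^'m"
  shows "(A *v x) \<bullet> y = x \<bullet> (transpose A *v y)"
  by (metis dot_lmul_matrix inner_commute transpose_matrix_vector transpose_transpose)

text \<open>Moving \<open>J\<close> to the other factor changes the sign, so the quadratic form
  equals its own negative. This is where losslessness enters.\<close>

lemma skew_symmetric_inner_zero:
  assumes "skew_symmetric J"
  shows "(J *v z) \<bullet> z = 0"
proof -
  have "(J *v z) \<bullet> z = z \<bullet> ((- J) *v z)"
    using assms matrix_vector_inner_transpose[of J z z] by (simp add: skew_symmetric_def)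
  also have "\<dots> = - ((J *v z) \<bullet> z)"
    by (simp add: inner_commute scaleR_matrix_vector_assoc[of "-1", simplified, symmetric])
  finally show ?thesis by simp
qed

text \<open>The \<open>J\<close> part of the power vanishes with \<open>z = Q *v x t\<close>, and
  moving \<open>B\<close> across the inner product leaves input times output. For the gauge integral
  used here, existence of the integral is part of the conclusion.\<close>

lemma trajectory_energy_balance:
  assumes J: "skew_symmetric J" and Q: "symmetric_positive_definite Q" and "T \<ge> 0"
    and x: "trajectory J Q B x0 T u x"
  shows "((\<lambda>t. u t \<bullet> ((transpose B ** Q) *v x t)) has_integral
           (x T \<bullet> (Q *v x T) - x0 \<bullet> (Q *v x0)) / 2) {0..T}"
proof -
  \<comment> \<open>This is twice the Hamiltonian; the factor 1/2 is restored at the end.\<close>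
  let ?H = "\<lambda>t. x t \<bullet> (Q *v x t)"
  let ?y = "\<lambda>t. (transpose B ** Q) *v x t"
  have ac: "absolutely_continuous_on 0 T x" and "x 0 = x0"
    and ae: "AE t in lebesgue. t \<in> {0<..<T} \<longrightarrow>
        (x has_vector_derivative ((J ** Q) *v x t + B *v u t)) (at t)"
    using x by (auto simp: trajectory_def)
  obtain N where N: "N \<in> null_sets lebesgue"
    and der: "\<And>t. t \<in> {0<..<T} - N \<Longrightarrow>
        (x has_vector_derivative ((J ** Q) *v x t + B *v u t)) (at t)"
    using AE_E3[OF ae] by (metis (no_types, lifting) DiffD1 DiffD2 DiffI UNIV_I space_completion space_lborel space_borel)
  have QT: "transpose Q = Q" using Q by (simp add: symmetric_positive_definite_def)
  have "((\<lambda>t. 2 * (u t \<bullet> ?y t)) has_integral (?H T - ?H 0)) {0..T}"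
  proof (rule fundamental_theorem_of_calculus_absolutely_continuous[OF \<open>T \<ge> 0\<close>])
    show "absolutely_continuous_on 0 T ?H"
      by (intro absolutely_continuous_on_bilinear[OF bounded_bilinear_inner] ac
          absolutely_continuous_on_linear[OF matrix_vector_mul_bounded_linear])
    \<comment> \<open>The endpoints join the exceptional set because the differential equation is
      imposed only on the open interval.\<close>
    show "negligible (N \<union> {0, T})"
      using N by (simp add: negligible_iff_null_sets[symmetric])
    fix t assume t: "t \<in> {0..T} - (N \<union> {0, T})"
    let ?x' = "(J ** Q) *v x t + B *v u t"
    have x': "(x has_vector_derivative ?x') (at t)"
      using t by (intro der) auto
    have "?x' \<bullet> (Q *v x t) = (J *v (Q *v x t)) \<bullet> (Q *v x t) + (B *v u t) \<bullet> (Q *v x t)"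
      by (simp add: inner_add_left matrix_vector_mul_assoc)
    also have "\<dots> = u t \<bullet> ?y t"
      unfolding skew_symmetric_inner_zero[OF J] matrix_vector_inner_transpose[of B]
      by (simp add: matrix_vector_mul_assoc)
    finally have power: "?x' \<bullet> (Q *v x t) = u t \<bullet> ?y t" .
    have "(?H has_vector_derivative (x t \<bullet> (Q *v ?x') + ?x' \<bullet> (Q *v x t))) (at t)"
      by (intro bounded_bilinear.has_vector_derivative[OF bounded_bilinear_inner] x'
          bounded_linear.has_vector_derivative[OF matrix_vector_mul_bounded_linear])
    \<comment> \<open>Symmetry of \<open>Q\<close> makes the two halves of the product rule
      equal.\<close>
    moreover have "x t \<bullet> (Q *v ?x') = ?x' \<bullet> (Q *v x t)"
      by (metis QT inner_commute matrix_vector_inner_transpose)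
    ultimately have "(?H has_vector_derivative 2 * (u t \<bullet> ?y t)) (at t)"
      using power by simp
    then show "(?H has_vector_derivative 2 * (u t \<bullet> ?y t)) (at t within {0..T})"
      by (rule has_vector_derivative_at_within)
  qed
  from has_integral_mult_right[OF this, of "1 / 2"] show ?thesis
    using \<open>x 0 = x0\<close> by simp
qed

section \<open>Uniqueness of the terminal state\<close>

text \<open>By linearity the common control cancels, leaving the homogeneous system started at the
  origin.\<close>

lemma trajectory_diff:
  assumes "trajectory J Q B x0 T u x" "trajectory J Q B x0 T u z"
  shows "trajectory J Q B 0 T (\<lambda>_. 0) (\<lambda>t. x t - z t)"
  unfolding trajectory_def
proof (intro conjI)
  show "absolutely_continuous_on 0 T (\<lambda>t. x t - z t)"
    using assms by (simp add: trajectory_def absolutely_continuous_on_diff)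
  show "x 0 - z 0 = 0" using assms by (simp add: trajectory_def)
  have "AE t in lebesgue. t \<in> {0<..<T} \<longrightarrow>
        (x has_vector_derivative ((J ** Q) *v x t + B *v u t)) (at t)"
    "AE t in lebesgue. t \<in> {0<..<T} \<longrightarrow>
        (z has_vector_derivative ((J ** Q) *v z t + B *v u t)) (at t)"
    using assms by (auto simp: trajectory_def)
  then show "AE t in lebesgue. t \<in> {0<..<T} \<longrightarrow>
     ((\<lambda>t. x t - z t) has_vector_derivative (J ** Q) *v (x t - z t) + B *v 0) (at t)"
  proof eventually_elim
    case (elim t)
    show ?case
    proof
      assume "t \<in> {0<..<T}"
      with elim have "((\<lambda>t. x t - z t) has_vector_derivative
          ((J ** Q) *v x t + B *v u t) - ((J ** Q) *v z t + B *v u t)) (at t)"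
        by (intro has_vector_derivative_diff) auto
      then show "((\<lambda>t. x t - z t) has_vector_derivative
          (J ** Q) *v (x t - z t) + B *v 0) (at t)"
        by (simp add: matrix_vector_mult_diff_distrib)
    qed
  qed
qed

text \<open>The difference starts with zero energy and receives none, so definiteness of
  \<open>Q\<close> forces it to vanish at \<open>T\<close>. This links \<open>state\<close>, an
  arbitrarily chosen trajectory, to the trajectory reaching \<open>xT\<close> that feasibility
  provides.\<close>

lemma trajectory_end_unique:
  assumes J: "skew_symmetric J" and Q: "symmetric_positive_definite Q" and "T \<ge> 0"
    and "trajectory J Q B x0 T u x" "trajectory J Q B x0 T u z"
  shows "x T = z T"
proof -
  let ?d = "\<lambda>t. x t - z t"
  have "((\<lambda>t. 0 :: real) has_integral (?d T \<bullet> (Q *v ?d T)) / 2) {0..T}"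
    using trajectory_energy_balance[OF J Q \<open>T \<ge> 0\<close> trajectory_diff[OF assms(4,5)]] by simp
  then have "?d T \<bullet> (Q *v ?d T) = 0"
    using has_integral_unique[OF _ has_integral_0] by fastforce
  then have "?d T = 0"
    using Q unfolding symmetric_positive_definite_def by (metis less_irrefl)
  then show ?thesis by simp
qed

section \<open>The objective value and the conclusion\<close>

text \<open>The energy balance is carried over from the gauge integral to the Lebesgue integral of
  the objective. The case \<open>T = 0\<close> is included, since the free problem admits
  it.\<close>

lemma feasible_supplied_energy:
  fixes B :: "real^'m^'n"
  assumes J: "skew_symmetric J" and Q: "symmetric_positive_definite Q" and "T \<ge> 0"
    and feas: "feasible J Q B U x0 xT T u"
  shows "supplied_energy J Q B x0 T u = (xT \<bullet> (Q *v xT) - x0 \<bullet> (Q *v x0)) / 2"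
proof -
  obtain z where u: "u \<in> L1_controls T U" and z: "trajectory J Q B x0 T u z" "z T = xT"
    using feas by (auto simp: feasible_def)
  let ?x = "state J Q B x0 T u"
  let ?S = "{0<..<T}"
  have x: "trajectory J Q B x0 T u ?x"
    unfolding state_def by (rule someI[of "trajectory J Q B x0 T u", OF z(1)])
  have xT: "?x T = xT"
    using trajectory_end_unique[OF J Q \<open>T \<ge> 0\<close> x z(1)] z(2) by simp
  have cont: "continuous_on {0..T} (\<lambda>t. (transpose B ** Q) *v ?x t)"
    using x unfolding trajectory_def
    by (intro linear_continuous_on_compose[OF absolutely_continuous_on_imp_continuous_on]) auto
  \<comment> \<open>The output is continuous, hence bounded and measurable, and \<open>u\<close> is
    integrable. Integrability of the product matters because the Lebesgue integral of a
    non-integrable function is 0 by convention, whatever its gauge integral.\<close>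
  have "(\<lambda>t. ((transpose B ** Q) *v ?x t) \<bullet> u t) absolutely_integrable_on ?S"
  proof (rule absolutely_integrable_bounded_measurable_product[where h = "(\<bullet>)"])
    show "bilinear ((\<bullet>) :: real^'m \<Rightarrow> real^'m \<Rightarrow> real)"
      using bilinear_conv_bounded_bilinear bounded_bilinear_inner by blast
    show "(\<lambda>t. (transpose B ** Q) *v ?x t) \<in> borel_measurable (lebesgue_on ?S)"
      by (intro continuous_imp_measurable_on_sets_lebesgue continuous_on_subset[OF cont]) auto
    have "bounded ((\<lambda>t. (transpose B ** Q) *v ?x t) ` {0..T})"
      using cont by (intro compact_imp_bounded compact_continuous_image) auto
    then show "bounded ((\<lambda>t. (transpose B ** Q) *v ?x t) ` ?S)"
      by (rule bounded_subset) auto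
    show "u absolutely_integrable_on ?S"
      using u by (simp add: L1_controls_def)
  qed auto
  then have ai: "(\<lambda>t. u t \<bullet> ((transpose B ** Q) *v ?x t)) absolutely_integrable_on ?S"
    by (simp add: inner_commute)
  \<comment> \<open>Passing from the closed to the open interval drops only two points.\<close>
  have "((\<lambda>t. u t \<bullet> ((transpose B ** Q) *v ?x t)) has_integral
           (xT \<bullet> (Q *v xT) - x0 \<bullet> (Q *v x0)) / 2) ?S"
    using trajectory_energy_balance[OF J Q \<open>T \<ge> 0\<close> x] 
    by (simp add: xT has_integral_Icc_iff_Ioo)
  then show ?thesis
    unfolding supplied_energy_def system_output_def
    by (simp add: set_lebesgue_integral_eq_integral(2)[OF ai] integral_unique)
qed

theorem lemma10:
  fixes J Q :: "real^'n^'n" and B :: "real^'m^'n"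
    and u_lo u_hi :: "real^'m" and x0 xT :: "real^'n" and T :: real
  assumes "skew_symmetric J"
    and "symmetric_positive_definite Q"
    and "CARD('m) \<le> CARD('n)" and "rank B = CARD('m)"
    and "0 \<in> interior (cbox u_lo u_hi)"
    and "T > 0"
    and "controllable (J ** Q) B"
  shows "(\<forall>u. feasible J Q B (cbox u_lo u_hi) x0 xT T u \<longrightarrow>
              optimal J Q B (cbox u_lo u_hi) x0 xT T u) \<and>
         (\<forall>T' u' u. feasible_free J Q B (cbox u_lo u_hi) x0 xT T' u' \<and>
              optimal J Q B (cbox u_lo u_hi) x0 xT T u \<longrightarrow>
              supplied_energy J Q B x0 T' u' = supplied_energy J Q B x0 T u)"
proof -
  \<comment> \<open>The right-hand side contains neither \<open>S\<close> nor \<open>u\<close>.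
    Taking \<open>S = T\<close> shows that all feasible controls tie, hence each is optimal;
    comparing \<open>S = T'\<close> with \<open>S = T\<close> gives the second claim.\<close>
  have energy: "supplied_energy J Q B x0 S u = (xT \<bullet> (Q *v xT) - x0 \<bullet> (Q *v x0)) / 2"
    if "feasible J Q B (cbox u_lo u_hi) x0 xT S u" "S \<ge> 0" for S u
    using feasible_supplied_energy[OF assms(1,2) that(2,1)] .
  show ?thesis
    using \<open>T > 0\<close> by (auto simp: optimal_def feasible_free_def energy)
qed

end
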